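(* Suppose $\mathcal{C}$ has an initial object $0$. Let $(T,\tau)$ be the companion of a functor $B\colon\mathcal{C}\to\mathcal{C}$ and let $(T,\eta,\mu)$ be the unique monad structure on $T$ for which $\tau$ is a distributive law of the monad over $B$. Then the $B$-coalgebra $(T0,\ \tau_0\circ T!_{B0})$ (where $!_{B0}\colon 0\to B0$ is the unique map) is a final $B$-coalgebra, and the algebra induced on it by $\tau$ is $\mu_0\colon TT0\to T0$.
   Context: The category $\mathrm{DL}(B)$ has as objects pairs $(F,\lambda)$ with $F\colon\mathcal{C}\to\mathcal{C}$ a functor and $\lambda\colon FB\Rightarrow BF$ natural; morphisms $(F,\lambda)\to(G,\rho)$ are natural $\kappa\colon F\Rightarrow G$ with $\rho\circ\kappa B=B\kappa\circ\lambda$. The companion is a final object of $\mathrm{DL}(B)$. There exist unique $\eta\colon\mathrm{Id}\Rightarrow T$, $\mu\colon TT\Rightarrow T$ making $(T,\eta,\mu)$ a monad with $B\eta=\tau\circ\eta B$ and $\tau\circ\mu B=B\mu\circ\tau T\circ T\tau$. Given a final coalgebra $(Z,\zeta)$ and a natural $\lambda\colon FB\Rightarrow BF$, the algebra induced by $\lambda$ is the unique $\alpha\colon FZ\to Z$ with $\zeta\circ\alpha=B\alpha\circ\lambda_Z\circ F\zeta$. *)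

theory Defs
  imports "HOL-Library.FuncSet"
begin

section \<open>Categories\<close>

record ('o, 'm) cat =
  Obj :: "'o set"
  Arr :: "'m set"
  Dom :: "'m \<Rightarrow> 'o"
  Cod :: "'m \<Rightarrow> 'o"
  Ide :: "'o \<Rightarrow> 'm"
  Cmp :: "'m \<Rightarrow> 'm \<Rightarrow> 'm"  (infixl \<open>\<cdot>\<index>\<close> 70)

definition Hom :: "('o, 'm) cat \<Rightarrow> 'o \<Rightarrow> 'o \<Rightarrow> 'm set" where
  "Hom C x y = {f \<in> Arr C. Dom C f = x \<and> Cod C f = y}"

locale category =
  fixes C :: "('o, 'm) cat" (structure)
  assumes Dom_in_Obj: "f \<in> Arr C \<Longrightarrow> Dom C f \<in> Obj C"
    and Cod_in_Obj: "f \<in> Arr C \<Longrightarrow> Cod C f \<in> Obj C"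
    and Ide_in_Hom: "x \<in> Obj C \<Longrightarrow> Ide C x \<in> Hom C x x"
    and Cmp_in_Hom: "\<lbrakk>f \<in> Hom C x y; g \<in> Hom C y z\<rbrakk> \<Longrightarrow> g \<cdot> f \<in> Hom C x z"
    and Cmp_Ide: "f \<in> Hom C x y \<Longrightarrow> f \<cdot> Ide C x = f"
    and Ide_Cmp: "f \<in> Hom C x y \<Longrightarrow> Ide C y \<cdot> f = f"
    and Cmp_assoc: "\<lbrakk>f \<in> Hom C x y; g \<in> Hom C y z; h \<in> Hom C z w\<rbrakk>
      \<Longrightarrow> (h \<cdot> g) \<cdot> f = h \<cdot> (g \<cdot> f)"

definition initial_object :: "('o, 'm) cat \<Rightarrow> 'o \<Rightarrow> bool" where
  "initial_object C z \<longleftrightarrow> z \<in> Obj C \<and> (\<forall>x \<in> Obj C. \<exists>!f. f \<in> Hom C z x)"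

definition final_object :: "('o, 'm) cat \<Rightarrow> 'o \<Rightarrow> bool" where
  "final_object C z \<longleftrightarrow> z \<in> Obj C \<and> (\<forall>x \<in> Obj C. \<exists>!f. f \<in> Hom C x z)"

definition initial_arrow :: "('o, 'm) cat \<Rightarrow> 'o \<Rightarrow> 'o \<Rightarrow> 'm" where
  "initial_arrow C z x = (THE f. f \<in> Hom C z x)"

section \<open>Endofunctors and natural transformations\<close>

text \<open>
  Functors and natural transformations are required to be \<^const>\<open>undefined\<close> outside the
  objects and arrows of the category. Thus HOL equality of functors (of natural transformations)
  is the mathematical equality, and unique existence has its usual meaning.
\<close>

record ('o, 'm) endo =
  fobj :: "'o \<Rightarrow> 'o"
  farr :: "'m \<Rightarrow> 'm"

definition endofunctor :: "('o, 'm) cat \<Rightarrow> ('o, 'm) endo \<Rightarrow> bool" where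
  "endofunctor C F \<longleftrightarrow>
     fobj F \<in> Obj C \<rightarrow>\<^sub>E Obj C \<and>
     farr F \<in> Arr C \<rightarrow>\<^sub>E Arr C \<and>
     (\<forall>x y. \<forall>f \<in> Hom C x y. farr F f \<in> Hom C (fobj F x) (fobj F y)) \<and>
     (\<forall>x \<in> Obj C. farr F (Ide C x) = Ide C (fobj F x)) \<and>
     (\<forall>x y z. \<forall>f \<in> Hom C x y. \<forall>g \<in> Hom C y z.
        farr F (g \<cdot>\<^bsub>C\<^esub> f) = farr F g \<cdot>\<^bsub>C\<^esub> farr F f)"

definition id_endo :: "('o, 'm) cat \<Rightarrow> ('o, 'm) endo" where
  "id_endo C = \<lparr>fobj = (\<lambda>x\<in>Obj C. x), farr = (\<lambda>f\<in>Arr C. f)\<rparr>"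

definition comp_endo :: "('o, 'm) cat \<Rightarrow> ('o, 'm) endo \<Rightarrow> ('o, 'm) endo \<Rightarrow> ('o, 'm) endo" where
  "comp_endo C F G = \<lparr>fobj = (\<lambda>x\<in>Obj C. fobj F (fobj G x)), farr = (\<lambda>f\<in>Arr C. farr F (farr G f))\<rparr>"

definition nat_trans ::
  "('o, 'm) cat \<Rightarrow> ('o, 'm) endo \<Rightarrow> ('o, 'm) endo \<Rightarrow> ('o \<Rightarrow> 'm) \<Rightarrow> bool" where
  "nat_trans C F G \<kappa> \<longleftrightarrow>
     \<kappa> \<in> extensional (Obj C) \<and>
     (\<forall>x \<in> Obj C. \<kappa> x \<in> Hom C (fobj F x) (fobj G x)) \<and>
     (\<forall>x y. \<forall>f \<in> Hom C x y. farr G f \<cdot>\<^bsub>C\<^esub> \<kappa> x = \<kappa> y \<cdot>\<^bsub>C\<^esub> farr F f)"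

definition id_nt :: "('o, 'm) cat \<Rightarrow> ('o, 'm) endo \<Rightarrow> 'o \<Rightarrow> 'm" where
  "id_nt C F = (\<lambda>x\<in>Obj C. Ide C (fobj F x))"

definition vcomp :: "('o, 'm) cat \<Rightarrow> ('o \<Rightarrow> 'm) \<Rightarrow> ('o \<Rightarrow> 'm) \<Rightarrow> 'o \<Rightarrow> 'm" where
  "vcomp C \<rho> \<kappa> = (\<lambda>x\<in>Obj C. \<rho> x \<cdot>\<^bsub>C\<^esub> \<kappa> x)"

text \<open>The whiskerings $\kappa F$ and $F \kappa$.\<close>

definition whisker_r :: "('o, 'm) cat \<Rightarrow> ('o \<Rightarrow> 'm) \<Rightarrow> ('o, 'm) endo \<Rightarrow> 'o \<Rightarrow> 'm" where
  "whisker_r C \<kappa> F = (\<lambda>x\<in>Obj C. \<kappa> (fobj F x))"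

definition whisker_l :: "('o, 'm) cat \<Rightarrow> ('o, 'm) endo \<Rightarrow> ('o \<Rightarrow> 'm) \<Rightarrow> 'o \<Rightarrow> 'm" where
  "whisker_l C F \<kappa> = (\<lambda>x\<in>Obj C. farr F (\<kappa> x))"

section \<open>Distributive laws and the companion\<close>

definition dist_law ::
  "('o, 'm) cat \<Rightarrow> ('o, 'm) endo \<Rightarrow> ('o, 'm) endo \<times> ('o \<Rightarrow> 'm) \<Rightarrow> bool" where
  "dist_law C B = (\<lambda>(F, \<phi>). endofunctor C F \<and>
     nat_trans C (comp_endo C F B) (comp_endo C B F) \<phi>)"

definition dist_law_morphism ::
  "('o, 'm) cat \<Rightarrow> ('o, 'm) endo \<Rightarrow> ('o, 'm) endo \<times> ('o \<Rightarrow> 'm) \<Rightarrow> ('o \<Rightarrow> 'm)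
    \<Rightarrow> ('o, 'm) endo \<times> ('o \<Rightarrow> 'm) \<Rightarrow> bool" where
  "dist_law_morphism C B = (\<lambda>(F, \<phi>) \<kappa> (G, \<rho>). nat_trans C F G \<kappa> \<and>
     vcomp C \<rho> (whisker_r C \<kappa> B) = vcomp C (whisker_l C B \<kappa>) \<phi>)"

text \<open>Arrows carry their source and target, since \<^const>\<open>Dom\<close> and \<^const>\<open>Cod\<close> are functions.\<close>

definition DL :: "('o, 'm) cat \<Rightarrow> ('o, 'm) endo \<Rightarrow>
    (('o, 'm) endo \<times> ('o \<Rightarrow> 'm),
     (('o, 'm) endo \<times> ('o \<Rightarrow> 'm)) \<times> ('o \<Rightarrow> 'm) \<times> (('o, 'm) endo \<times> ('o \<Rightarrow> 'm))) cat" where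
  "DL C B = \<lparr>
     Obj = {X. dist_law C B X},
     Arr = {(X, \<kappa>, Y). dist_law C B X \<and> dist_law C B Y \<and> dist_law_morphism C B X \<kappa> Y},
     Dom = (\<lambda>(X, \<kappa>, Y). X),
     Cod = (\<lambda>(X, \<kappa>, Y). Y),
     Ide = (\<lambda>X. (X, id_nt C (fst X), X)),
     Cmp = (\<lambda>(Y', \<rho>, Z) (X, \<kappa>, Y). (X, vcomp C \<rho> \<kappa>, Z))\<rparr>"

definition companion ::
  "('o, 'm) cat \<Rightarrow> ('o, 'm) endo \<Rightarrow> ('o, 'm) endo \<times> ('o \<Rightarrow> 'm) \<Rightarrow> bool" where
  "companion C B X \<longleftrightarrow> final_object (DL C B) X"

definition monad ::
  "('o, 'm) cat \<Rightarrow> ('o, 'm) endo \<Rightarrow> ('o \<Rightarrow> 'm) \<Rightarrow> ('o \<Rightarrow> 'm) \<Rightarrow> bool" where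
  "monad C T \<eta> \<mu> \<longleftrightarrow>
     endofunctor C T \<and>
     nat_trans C (id_endo C) T \<eta> \<and>
     nat_trans C (comp_endo C T T) T \<mu> \<and>
     vcomp C \<mu> (whisker_r C \<eta> T) = id_nt C T \<and>
     vcomp C \<mu> (whisker_l C T \<eta>) = id_nt C T \<and>
     vcomp C \<mu> (whisker_r C \<mu> T) = vcomp C \<mu> (whisker_l C T \<mu>)"

definition monad_dist_law ::
  "('o, 'm) cat \<Rightarrow> ('o, 'm) endo \<Rightarrow> ('o, 'm) endo \<Rightarrow> ('o \<Rightarrow> 'm) \<Rightarrow> ('o \<Rightarrow> 'm) \<Rightarrow> ('o \<Rightarrow> 'm) \<Rightarrow> bool" where
  "monad_dist_law C B T \<eta> \<mu> \<tau> \<longleftrightarrow>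
     dist_law C B (T, \<tau>) \<and>
     whisker_l C B \<eta> = vcomp C \<tau> (whisker_r C \<eta> B) \<and>
     vcomp C \<tau> (whisker_r C \<mu> B) =
       vcomp C (whisker_l C B \<mu>) (vcomp C (whisker_r C \<tau> T) (whisker_l C T \<tau>))"

section \<open>Coalgebras\<close>

definition coalgebra :: "('o, 'm) cat \<Rightarrow> ('o, 'm) endo \<Rightarrow> 'o \<times> 'm \<Rightarrow> bool" where
  "coalgebra C B = (\<lambda>(X, f). X \<in> Obj C \<and> f \<in> Hom C X (fobj B X))"

definition coalgebra_morphism ::
  "('o, 'm) cat \<Rightarrow> ('o, 'm) endo \<Rightarrow> 'o \<times> 'm \<Rightarrow> 'm \<Rightarrow> 'o \<times> 'm \<Rightarrow> bool" where
  "coalgebra_morphism C B = (\<lambda>(X, f) h (Y, g).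
     h \<in> Hom C X Y \<and> g \<cdot>\<^bsub>C\<^esub> h = farr B h \<cdot>\<^bsub>C\<^esub> f)"

definition Coalg :: "('o, 'm) cat \<Rightarrow> ('o, 'm) endo \<Rightarrow> ('o \<times> 'm, ('o \<times> 'm) \<times> 'm \<times> ('o \<times> 'm)) cat" where
  "Coalg C B = \<lparr>
     Obj = {X. coalgebra C B X},
     Arr = {(X, h, Y). coalgebra C B X \<and> coalgebra C B Y \<and> coalgebra_morphism C B X h Y},
     Dom = (\<lambda>(X, h, Y). X),
     Cod = (\<lambda>(X, h, Y). Y),
     Ide = (\<lambda>X. (X, Ide C (fst X), X)),
     Cmp = (\<lambda>(Y', k, Z) (X, h, Y). (X, k \<cdot>\<^bsub>C\<^esub> h, Z))\<rparr>"

definition final_coalgebra :: "('o, 'm) cat \<Rightarrow> ('o, 'm) endo \<Rightarrow> 'o \<times> 'm \<Rightarrow> bool" where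
  "final_coalgebra C B X \<longleftrightarrow> final_object (Coalg C B) X"

text \<open>
  \<open>induced_algebra C B (Z, \<zeta>) (F, \<phi>) \<alpha>\<close>: \<open>\<alpha>\<close> is the one and only algebra \<open>F Z \<rightarrow> Z\<close> with
  \<open>\<zeta> \<circ> \<alpha> = B \<alpha> \<circ> \<phi>\<^sub>Z \<circ> F \<zeta>\<close>.
\<close>

definition induced_algebra_eq ::
  "('o, 'm) cat \<Rightarrow> ('o, 'm) endo \<Rightarrow> 'o \<times> 'm \<Rightarrow> ('o, 'm) endo \<times> ('o \<Rightarrow> 'm) \<Rightarrow> 'm \<Rightarrow> bool" where
  "induced_algebra_eq C B = (\<lambda>(Z, \<zeta>) (F, \<phi>) \<alpha>. \<alpha> \<in> Hom C (fobj F Z) Z \<and>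
     \<zeta> \<cdot>\<^bsub>C\<^esub> \<alpha> = farr B \<alpha> \<cdot>\<^bsub>C\<^esub> (\<phi> Z \<cdot>\<^bsub>C\<^esub> farr F \<zeta>))"

definition induced_algebra ::
  "('o, 'm) cat \<Rightarrow> ('o, 'm) endo \<Rightarrow> 'o \<times> 'm \<Rightarrow> ('o, 'm) endo \<times> ('o \<Rightarrow> 'm) \<Rightarrow> 'm \<Rightarrow> bool" where
  "induced_algebra C B Z X \<alpha> \<longleftrightarrow>
     induced_algebra_eq C B Z X \<alpha> \<and> (\<forall>\<beta>. induced_algebra_eq C B Z X \<beta> \<longrightarrow> \<beta> = \<alpha>)"

section \<open>The two constructions are categories\<close>

lemma endofunctorD:
  assumes "endofunctor C F"
  shows "x \<in> Obj C \<Longrightarrow> fobj F x \<in> Obj C"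
    and "f \<in> Hom C x y \<Longrightarrow> farr F f \<in> Hom C (fobj F x) (fobj F y)"
    and "x \<in> Obj C \<Longrightarrow> farr F (Ide C x) = Ide C (fobj F x)"
    and "f \<in> Hom C x y \<Longrightarrow> g \<in> Hom C y z \<Longrightarrow> farr F (g \<cdot>\<^bsub>C\<^esub> f) = farr F g \<cdot>\<^bsub>C\<^esub> farr F f"
  using assms unfolding endofunctor_def by blast+

lemma nat_transD:
  assumes "nat_trans C F G \<kappa>"
  shows "\<kappa> \<in> extensional (Obj C)"
    and "x \<in> Obj C \<Longrightarrow> \<kappa> x \<in> Hom C (fobj F x) (fobj G x)"
    and "f \<in> Hom C x y \<Longrightarrow> farr G f \<cdot>\<^bsub>C\<^esub> \<kappa> x = \<kappa> y \<cdot>\<^bsub>C\<^esub> farr F f"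
  using assms unfolding nat_trans_def by blast+

context category
begin

lemma Hom_Obj:
  assumes "f \<in> Hom C x y" shows "x \<in> Obj C" "y \<in> Obj C"
  using assms Dom_in_Obj Cod_in_Obj by (auto simp: Hom_def)

lemma nat_trans_id_nt:
  assumes F: "endofunctor C F" shows "nat_trans C F F (id_nt C F)"
  unfolding nat_trans_def
proof (intro conjI allI ballI)
  show "id_nt C F \<in> extensional (Obj C)" by (simp add: id_nt_def)
  show "id_nt C F x \<in> Hom C (fobj F x) (fobj F x)" if "x \<in> Obj C" for x
    using that endofunctorD(1)[OF F] Ide_in_Hom by (simp add: id_nt_def)
  show "farr F f \<cdot> id_nt C F x = id_nt C F y \<cdot> farr F f" if f: "f \<in> Hom C x y" for x y f
    using Hom_Obj[OF f] Cmp_Ide[OF endofunctorD(2)[OF F f]] Ide_Cmp[OF endofunctorD(2)[OF F f]]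
    by (simp add: id_nt_def)
qed

lemma nat_trans_vcomp:
  assumes F: "endofunctor C F" and G: "endofunctor C G" and H: "endofunctor C H"
    and \<kappa>: "nat_trans C F G \<kappa>" and \<rho>: "nat_trans C G H \<rho>"
  shows "nat_trans C F H (vcomp C \<rho> \<kappa>)"
  unfolding nat_trans_def
proof (intro conjI allI ballI)
  show "vcomp C \<rho> \<kappa> \<in> extensional (Obj C)" by (simp add: vcomp_def)
  show "vcomp C \<rho> \<kappa> x \<in> Hom C (fobj F x) (fobj H x)" if "x \<in> Obj C" for x
    using that Cmp_in_Hom[OF nat_transD(2)[OF \<kappa> that] nat_transD(2)[OF \<rho> that]]
    by (simp add: vcomp_def)
  fix x y f assume f: "f \<in> Hom C x y"
  note xy = Hom_Obj[OF f]
  note k = nat_transD(2)[OF \<kappa>] and r = nat_transD(2)[OF \<rho>]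
  have "farr H f \<cdot> (\<rho> x \<cdot> \<kappa> x) = (farr H f \<cdot> \<rho> x) \<cdot> \<kappa> x"
    using Cmp_assoc[OF k[OF xy(1)] r[OF xy(1)] endofunctorD(2)[OF H f]] by simp
  also have "\<dots> = (\<rho> y \<cdot> farr G f) \<cdot> \<kappa> x" using nat_transD(3)[OF \<rho> f] by simp
  also have "\<dots> = \<rho> y \<cdot> (farr G f \<cdot> \<kappa> x)"
    by (rule Cmp_assoc[OF k[OF xy(1)] endofunctorD(2)[OF G f] r[OF xy(2)]])
  also have "\<dots> = \<rho> y \<cdot> (\<kappa> y \<cdot> farr F f)" using nat_transD(3)[OF \<kappa> f] by simp
  also have "\<dots> = (\<rho> y \<cdot> \<kappa> y) \<cdot> farr F f"
    using Cmp_assoc[OF endofunctorD(2)[OF F f] k[OF xy(2)] r[OF xy(2)]] by simp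
  finally show "farr H f \<cdot> vcomp C \<rho> \<kappa> x = vcomp C \<rho> \<kappa> y \<cdot> farr F f"
    using xy by (simp add: vcomp_def)
qed

lemma vcomp_id:
  assumes "nat_trans C F G \<kappa>"
  shows "vcomp C \<kappa> (id_nt C F) = \<kappa>" "vcomp C (id_nt C G) \<kappa> = \<kappa>"
proof -
  note k = nat_transD(2)[OF assms] and e = nat_transD(1)[OF assms]
  show "vcomp C \<kappa> (id_nt C F) = \<kappa>"
    by (rule extensionalityI[OF _ e]) (auto simp: vcomp_def id_nt_def Cmp_Ide[OF k])
  show "vcomp C (id_nt C G) \<kappa> = \<kappa>"
    by (rule extensionalityI[OF _ e]) (auto simp: vcomp_def id_nt_def Ide_Cmp[OF k])
qed

lemma vcomp_assoc:
  assumes "nat_trans C F G \<kappa>" "nat_trans C G H \<rho>" "nat_trans C H K \<sigma>"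
  shows "vcomp C (vcomp C \<sigma> \<rho>) \<kappa> = vcomp C \<sigma> (vcomp C \<rho> \<kappa>)"
  unfolding vcomp_def
  by (rule restrict_ext)
    (simp add: Cmp_assoc[OF nat_transD(2)[OF assms(1)] nat_transD(2)[OF assms(2)]
        nat_transD(2)[OF assms(3)]])

lemma dist_law_morphismD:
  assumes "dist_law_morphism C B (F, \<phi>) \<kappa> (G, \<rho>)" "x \<in> Obj C"
  shows "\<rho> x \<cdot> \<kappa> (fobj B x) = farr B (\<kappa> x) \<cdot> \<phi> x"
proof -
  have "vcomp C \<rho> (whisker_r C \<kappa> B) x = vcomp C (whisker_l C B \<kappa>) \<phi> x"
    using assms(1) by (simp add: dist_law_morphism_def)
  then show ?thesis
    using assms(2) by (simp add: vcomp_def whisker_r_def whisker_l_def)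
qed

lemma dist_lawD:
  assumes "dist_law C B (F, \<phi>)"
  shows "endofunctor C F"
    and "x \<in> Obj C \<Longrightarrow> \<phi> x \<in> Hom C (fobj F (fobj B x)) (fobj B (fobj F x))"
  using assms nat_transD(2)[of C "comp_endo C F B" "comp_endo C B F" \<phi> x]
  by (auto simp: dist_law_def comp_endo_def)

lemma dist_law_morphism_id:
  assumes B: "endofunctor C B" and X: "dist_law C B (F, \<phi>)"
  shows "dist_law_morphism C B (F, \<phi>) (id_nt C F) (F, \<phi>)"
proof -
  note F = dist_lawD(1)[OF X] and l = dist_lawD(2)[OF X]
  have "\<phi> x \<cdot> Ide C (fobj F (fobj B x)) = farr B (Ide C (fobj F x)) \<cdot> \<phi> x"
    if "x \<in> Obj C" for x
    using that Cmp_Ide[OF l[OF that]] Ide_Cmp[OF l[OF that]] endofunctorD(3)[OF B]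
      endofunctorD(1)[OF F] by simp
  then show ?thesis
    using nat_trans_id_nt[OF F] endofunctorD(1)[OF B]
    by (auto simp: dist_law_morphism_def vcomp_def whisker_r_def whisker_l_def id_nt_def
        intro!: restrict_ext)
qed

lemma dist_law_morphism_vcomp:
  assumes B: "endofunctor C B"
    and X: "dist_law C B (F, \<phi>)" and Y: "dist_law C B (G, \<gamma>)" and Z: "dist_law C B (H, \<theta>)"
    and \<kappa>: "dist_law_morphism C B (F, \<phi>) \<kappa> (G, \<gamma>)"
    and \<rho>: "dist_law_morphism C B (G, \<gamma>) \<rho> (H, \<theta>)"
  shows "dist_law_morphism C B (F, \<phi>) (vcomp C \<rho> \<kappa>) (H, \<theta>)"
proof -
  have n\<kappa>: "nat_trans C F G \<kappa>" and n\<rho>: "nat_trans C G H \<rho>"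
    using \<kappa> \<rho> by (auto simp: dist_law_morphism_def)
  note k = nat_transD(2)[OF n\<kappa>] and r = nat_transD(2)[OF n\<rho>]
  note B2 = endofunctorD(2)[OF B]
  have "\<theta> x \<cdot> (\<rho> (fobj B x) \<cdot> \<kappa> (fobj B x)) = farr B (\<rho> x \<cdot> \<kappa> x) \<cdot> \<phi> x"
    if x: "x \<in> Obj C" for x
  proof -
    note Bx = endofunctorD(1)[OF B x]
    have "\<theta> x \<cdot> (\<rho> (fobj B x) \<cdot> \<kappa> (fobj B x)) = (\<theta> x \<cdot> \<rho> (fobj B x)) \<cdot> \<kappa> (fobj B x)"
      using Cmp_assoc[OF k[OF Bx] r[OF Bx] dist_lawD(2)[OF Z x]] by simp
    also have "\<dots> = (farr B (\<rho> x) \<cdot> \<gamma> x) \<cdot> \<kappa> (fobj B x)"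
      using dist_law_morphismD[OF \<rho> x] by simp
    also have "\<dots> = farr B (\<rho> x) \<cdot> (\<gamma> x \<cdot> \<kappa> (fobj B x))"
      by (rule Cmp_assoc[OF k[OF Bx] dist_lawD(2)[OF Y x] B2[OF r[OF x]]])
    also have "\<dots> = farr B (\<rho> x) \<cdot> (farr B (\<kappa> x) \<cdot> \<phi> x)"
      using dist_law_morphismD[OF \<kappa> x] by simp
    also have "\<dots> = (farr B (\<rho> x) \<cdot> farr B (\<kappa> x)) \<cdot> \<phi> x"
      using Cmp_assoc[OF dist_lawD(2)[OF X x] B2[OF k[OF x]] B2[OF r[OF x]]] by simp
    finally show ?thesis using endofunctorD(4)[OF B k[OF x] r[OF x]] by simp
  qed
  then show ?thesis
    using nat_trans_vcomp[OF dist_lawD(1)[OF X] dist_lawD(1)[OF Y] dist_lawD(1)[OF Z] n\<kappa> n\<rho>]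
      endofunctorD(1)[OF B]
    by (auto simp: dist_law_morphism_def vcomp_def whisker_r_def whisker_l_def intro!: restrict_ext)
qed

lemma Hom_DL:
  "Hom (DL C B) X Y = {(X, \<kappa>, Y) |\<kappa>. dist_law C B X \<and> dist_law C B Y \<and> dist_law_morphism C B X \<kappa> Y}"
  by (auto simp: Hom_def DL_def)

lemma category_DL:
  assumes B: "endofunctor C B"
  shows "category (DL C B)"
proof
  show "Dom (DL C B) f \<in> Obj (DL C B)" if "f \<in> Arr (DL C B)" for f
    using that by (auto simp: DL_def)
  show "Cod (DL C B) f \<in> Obj (DL C B)" if "f \<in> Arr (DL C B)" for f
    using that by (auto simp: DL_def)
  show "Ide (DL C B) X \<in> Hom (DL C B) X X" if "X \<in> Obj (DL C B)" for X
    using that dist_law_morphism_id[OF B, of "fst X" "snd X"]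
    unfolding Hom_DL by (auto simp: DL_def)
  show "Cmp (DL C B) g f \<in> Hom (DL C B) X Z"
    if "f \<in> Hom (DL C B) X Y" "g \<in> Hom (DL C B) Y Z" for f g X Y Z
    using that dist_law_morphism_vcomp[OF B, of "fst X" "snd X" "fst Y" "snd Y" "fst Z" "snd Z"]
    unfolding Hom_DL by (auto simp: DL_def)
  show "Cmp (DL C B) f (Ide (DL C B) X) = f" if "f \<in> Hom (DL C B) X Y" for f X Y
    using that unfolding Hom_DL
    by (cases X; cases Y) (auto simp: DL_def dist_law_morphism_def vcomp_id)
  show "Cmp (DL C B) (Ide (DL C B) Y) f = f" if "f \<in> Hom (DL C B) X Y" for f X Y
    using that unfolding Hom_DL
    by (cases X; cases Y) (auto simp: DL_def dist_law_morphism_def vcomp_id)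
  show "Cmp (DL C B) (Cmp (DL C B) h g) f = Cmp (DL C B) h (Cmp (DL C B) g f)"
    if "f \<in> Hom (DL C B) X Y" "g \<in> Hom (DL C B) Y Z" "h \<in> Hom (DL C B) Z W" for f g h X Y Z W
    using that unfolding Hom_DL
    by (cases X; cases Y; cases Z; cases W) (auto simp: DL_def dist_law_morphism_def vcomp_assoc)
qed

lemma Hom_Coalg:
  "Hom (Coalg C B) X Y =
    {(X, h, Y) |h. coalgebra C B X \<and> coalgebra C B Y \<and> coalgebra_morphism C B X h Y}"
  by (auto simp: Hom_def Coalg_def)

lemma coalgebra_morphism_id:
  assumes B: "endofunctor C B" and X: "coalgebra C B (X, f)"
  shows "coalgebra_morphism C B (X, f) (Ide C X) (X, f)"
  using X Ide_in_Hom[of X] Cmp_Ide[of f X "fobj B X"] Ide_Cmp[of f X "fobj B X"] endofunctorD(3)[OF B]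
  by (auto simp: coalgebra_def coalgebra_morphism_def)

lemma coalgebra_morphism_Cmp:
  assumes B: "endofunctor C B"
    and X: "coalgebra C B (X, f)" and Y: "coalgebra C B (Y, g)" and Z: "coalgebra C B (Z, e)"
    and h: "coalgebra_morphism C B (X, f) h (Y, g)" and k: "coalgebra_morphism C B (Y, g) k (Z, e)"
  shows "coalgebra_morphism C B (X, f) (k \<cdot> h) (Z, e)"
proof -
  have F: "f \<in> Hom C X (fobj B X)" and G: "g \<in> Hom C Y (fobj B Y)" and E: "e \<in> Hom C Z (fobj B Z)"
    and H: "h \<in> Hom C X Y" and K: "k \<in> Hom C Y Z"
    and Hc: "g \<cdot> h = farr B h \<cdot> f" and Kc: "e \<cdot> k = farr B k \<cdot> g"
    using X Y Z h k by (auto simp: coalgebra_def coalgebra_morphism_def)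
  note B2 = endofunctorD(2)[OF B]
  have "e \<cdot> (k \<cdot> h) = (e \<cdot> k) \<cdot> h" using Cmp_assoc[OF H K E] by simp
  also have "\<dots> = farr B k \<cdot> (g \<cdot> h)" using Cmp_assoc[OF H G B2[OF K]] Kc by simp
  also have "\<dots> = (farr B k \<cdot> farr B h) \<cdot> f" using Cmp_assoc[OF F B2[OF H] B2[OF K]] Hc by simp
  finally show ?thesis
    using endofunctorD(4)[OF B H K] Cmp_in_Hom[OF H K] by (simp add: coalgebra_morphism_def)
qed

lemma category_Coalg:
  assumes B: "endofunctor C B"
  shows "category (Coalg C B)"
proof
  show "Dom (Coalg C B) f \<in> Obj (Coalg C B)" if "f \<in> Arr (Coalg C B)" for f
    using that by (auto simp: Coalg_def)
  show "Cod (Coalg C B) f \<in> Obj (Coalg C B)" if "f \<in> Arr (Coalg C B)" for f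
    using that by (auto simp: Coalg_def)
  show "Ide (Coalg C B) X \<in> Hom (Coalg C B) X X" if "X \<in> Obj (Coalg C B)" for X
    using that coalgebra_morphism_id[OF B, of "fst X" "snd X"]
    unfolding Hom_Coalg by (auto simp: Coalg_def)
  show "Cmp (Coalg C B) g f \<in> Hom (Coalg C B) X Z"
    if "f \<in> Hom (Coalg C B) X Y" "g \<in> Hom (Coalg C B) Y Z" for f g X Y Z
    using that coalgebra_morphism_Cmp[OF B, of "fst X" "snd X" "fst Y" "snd Y" "fst Z" "snd Z"]
    unfolding Hom_Coalg by (auto simp: Coalg_def)
  show "Cmp (Coalg C B) f (Ide (Coalg C B) X) = f" if "f \<in> Hom (Coalg C B) X Y" for f X Y
    using that unfolding Hom_Coalg
    by (cases X; cases Y) (auto simp: Coalg_def coalgebra_morphism_def Cmp_Ide)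
  show "Cmp (Coalg C B) (Ide (Coalg C B) Y) f = f" if "f \<in> Hom (Coalg C B) X Y" for f X Y
    using that unfolding Hom_Coalg
    by (cases X; cases Y) (auto simp: Coalg_def coalgebra_morphism_def Ide_Cmp)
  show "Cmp (Coalg C B) (Cmp (Coalg C B) h g) f = Cmp (Coalg C B) h (Cmp (Coalg C B) g f)"
    if "f \<in> Hom (Coalg C B) X Y" "g \<in> Hom (Coalg C B) Y Z" "h \<in> Hom (Coalg C B) Z W"
    for f g h X Y Z W
    using that unfolding Hom_Coalg
    by (cases X; cases Y; cases Z; cases W) (auto simp: Coalg_def coalgebra_morphism_def Cmp_assoc)
qed

end

end

theory Submission
  imports Defs
begin

text \<open>
  A coalgebra \<open>f : X \<rightarrow> B X\<close> is the same thing as a distributive law of the constant functor at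
  \<open>X\<close> over \<open>B\<close>, all of whose components are \<open>f\<close>. By naturality, a transformation from this
  constant functor to \<open>T\<close> is determined by its component \<open>h : X \<rightarrow> T 0\<close>, the component at \<open>Y\<close>
  being \<open>T !\<^sub>Y \<circ> h\<close>; it is a morphism of distributive laws into \<open>(T, \<tau>)\<close> exactly when \<open>h\<close> is a
  coalgebra morphism into \<open>(T 0, \<tau>\<^sub>0 \<circ> T !)\<close>. So finality of the companion yields finality of this
  coalgebra. The multiplication law of \<open>\<tau>\<close> at \<open>0\<close> together with naturality of \<open>\<mu>\<close> says that
  \<open>\<mu>\<^sub>0\<close> is a coalgebra morphism out of \<open>(T T 0, \<tau>\<^sub>T\<^sub>0 \<circ> T \<zeta>)\<close>, which is the defining equation of
  the induced algebra.
\<close>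

text \<open>The restrictions to objects and arrows give the value \<open>undefined\<close>
  elsewhere, as \<open>endofunctor\<close> demands, so that these functors can occur in objects of
  \<open>DL C B\<close>.\<close>

definition const_endo :: "('o, 'm) cat \<Rightarrow> 'o \<Rightarrow> ('o, 'm) endo" where
  "const_endo C X = \<lparr>fobj = (\<lambda>x\<in>Obj C. X), farr = (\<lambda>f\<in>Arr C. Ide C X)\<rparr>"

lemma Hom_Arr: "f \<in> Hom C x y \<Longrightarrow> f \<in> Arr C"
  by (simp add: Hom_def)

section \<open>Arrows out of the initial object\<close>

lemma initial_arrow_in_Hom:
  assumes "initial_object C z" "x \<in> Obj C"
  shows "initial_arrow C z x \<in> Hom C z x"
proof -
  have "\<exists>!f. f \<in> Hom C z x" using assms by (simp add: initial_object_def)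
  from theI'[OF this] show ?thesis by (simp add: initial_arrow_def)
qed

lemma initial_arrow_unique:
  assumes "initial_object C z" "x \<in> Obj C" "f \<in> Hom C z x"
  shows "f = initial_arrow C z x"
  using assms initial_arrow_in_Hom[OF assms(1,2)] unfolding initial_object_def by blast

context category
begin

lemma initial_arrow_Cmp:
  assumes "initial_object C z" "f \<in> Hom C x y"
  shows "f \<cdot> initial_arrow C z x = initial_arrow C z y"
  using initial_arrow_unique[OF assms(1) Hom_Obj(2)[OF assms(2)]]
    Cmp_in_Hom[OF initial_arrow_in_Hom[OF assms(1) Hom_Obj(1)[OF assms(2)]] assms(2)] by blast

lemma initial_arrow_self:
  assumes "initial_object C z"
  shows "initial_arrow C z z = Ide C z"
proof -
  have "z \<in> Obj C" using assms by (simp add: initial_object_def)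
  then show ?thesis using initial_arrow_unique[OF assms] Ide_in_Hom by metis
qed

section \<open>Coalgebras as distributive laws of constant functors\<close>

lemma endofunctor_const_endo:
  assumes X: "X \<in> Obj C"
  shows "endofunctor C (const_endo C X)"
  unfolding endofunctor_def
proof (intro conjI allI ballI)
  note I = Ide_in_Hom[OF X]
  show "fobj (const_endo C X) \<in> Obj C \<rightarrow>\<^sub>E Obj C" using X by (auto simp: const_endo_def)
  show "farr (const_endo C X) \<in> Arr C \<rightarrow>\<^sub>E Arr C"
    using Hom_Arr[OF I] by (auto simp: const_endo_def)
  show "farr (const_endo C X) f \<in> Hom C (fobj (const_endo C X) x) (fobj (const_endo C X) y)"
    if "f \<in> Hom C x y" for x y f
    using Hom_Obj[OF that] Hom_Arr[OF that] I by (simp add: const_endo_def)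
  show "farr (const_endo C X) (Ide C x) = Ide C (fobj (const_endo C X) x)" if "x \<in> Obj C" for x
    using that Hom_Arr[OF Ide_in_Hom[OF that]] by (simp add: const_endo_def)
  show "farr (const_endo C X) (g \<cdot> f) = farr (const_endo C X) g \<cdot> farr (const_endo C X) f"
    if "f \<in> Hom C x y" "g \<in> Hom C y w" for x y w f g
    using Hom_Arr[OF that(1)] Hom_Arr[OF that(2)] Hom_Arr[OF Cmp_in_Hom[OF that]] Cmp_Ide[OF I]
    by (simp add: const_endo_def)
qed

text \<open>Composing with \<open>B\<close> on either side leaves the functor constant, at
  \<open>X\<close> or at \<open>B X\<close>. Every arrow goes to an identity, so each naturality
  square collapses to \<open>f\<close> equals \<open>f\<close>.\<close>

lemma dist_law_const_endo:
  assumes B: "endofunctor C B" and f: "coalgebra C B (X, f)"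
  shows "dist_law C B (const_endo C X, \<lambda>x\<in>Obj C. f)"
proof -
  have X: "X \<in> Obj C" and F: "f \<in> Hom C X (fobj B X)"
    using f by (auto simp: coalgebra_def)
  note B1 = endofunctorD(1)[OF B]
  have "nat_trans C (comp_endo C (const_endo C X) B) (comp_endo C B (const_endo C X)) (\<lambda>x\<in>Obj C. f)"
    unfolding nat_trans_def
  proof (intro conjI allI ballI)
    show "(\<lambda>x\<in>Obj C. f) \<in> extensional (Obj C)" by simp
    show "(\<lambda>x\<in>Obj C. f) x \<in> Hom C (fobj (comp_endo C (const_endo C X) B) x)
        (fobj (comp_endo C B (const_endo C X)) x)" if "x \<in> Obj C" for x
      using that F B1 by (simp add: comp_endo_def const_endo_def)
    show "farr (comp_endo C B (const_endo C X)) g \<cdot> (\<lambda>x\<in>Obj C. f) x =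
        (\<lambda>x\<in>Obj C. f) y \<cdot> farr (comp_endo C (const_endo C X) B) g" if "g \<in> Hom C x y" for x y g
      using Hom_Obj[OF that] Hom_Arr[OF that] Hom_Arr[OF endofunctorD(2)[OF B that]]
        Cmp_Ide[OF F] Ide_Cmp[OF F] endofunctorD(3)[OF B X]
      by (simp add: comp_endo_def const_endo_def)
  qed
  then show ?thesis using endofunctor_const_endo[OF X] by (simp add: dist_law_def)
qed

section \<open>Morphisms from constant laws versus coalgebra morphisms\<close>

lemma dist_law_natural:
  assumes B: "endofunctor C B" and X: "dist_law C B (F, \<phi>)" and g: "g \<in> Hom C x y"
  shows "farr B (farr F g) \<cdot> \<phi> x = \<phi> y \<cdot> farr F (farr B g)"
proof -
  have "nat_trans C (comp_endo C F B) (comp_endo C B F) \<phi>" using X by (simp add: dist_law_def)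
  from nat_transD(3)[OF this g] show ?thesis
    using Hom_Arr[OF g] by (simp add: comp_endo_def)
qed

lemma coalgebra_dist_law_initial:
  assumes B: "endofunctor C B" and z: "initial_object C z" and T: "dist_law C B (T, \<tau>)"
  shows "coalgebra C B (fobj T z, \<tau> z \<cdot> farr T (initial_arrow C z (fobj B z)))"
proof -
  have zO: "z \<in> Obj C" using z by (simp add: initial_object_def)
  note i = initial_arrow_in_Hom[OF z endofunctorD(1)[OF B zO]]
  show ?thesis
    using endofunctorD(1)[OF dist_lawD(1)[OF T] zO]
      Cmp_in_Hom[OF endofunctorD(2)[OF dist_lawD(1)[OF T] i] dist_lawD(2)[OF T zO]]
    by (simp add: coalgebra_def)
qed

text \<open>This is the naturality square at \<open>!_x : z \<rightarrow> x\<close>, which the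
  constant functor sends to an identity. Hence \<kappa> is determined by its component at
  \<open>z\<close>.\<close>

lemma nat_trans_const_endo_initial:
  assumes z: "initial_object C z" and \<kappa>: "nat_trans C (const_endo C X) T \<kappa>"
    and x: "x \<in> Obj C"
  shows "\<kappa> x = farr T (initial_arrow C z x) \<cdot> \<kappa> z"
proof -
  note i = initial_arrow_in_Hom[OF z x]
  have k: "\<kappa> x \<in> Hom C X (fobj T x)"
    using nat_transD(2)[OF \<kappa> x] x by (simp add: const_endo_def)
  show ?thesis
    using nat_transD(3)[OF \<kappa> i] Hom_Arr[OF i] Cmp_Ide[OF k] by (simp add: const_endo_def)
qed

text \<open>The morphism equation of \<kappa>, read at \<open>z\<close>, involves the component at
  \<open>B z\<close>; rewriting that as \<open>T ! \<circ> \<kappa> z\<close> turns it into the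
  coalgebra square.\<close>

lemma coalgebra_morphism_of_const_morphism:
  assumes B: "endofunctor C B" and z: "initial_object C z" and T: "dist_law C B (T, \<tau>)"
    and \<kappa>: "dist_law_morphism C B (const_endo C X, \<lambda>x\<in>Obj C. f) \<kappa> (T, \<tau>)"
  shows "coalgebra_morphism C B (X, f) (\<kappa> z)
    (fobj T z, \<tau> z \<cdot> farr T (initial_arrow C z (fobj B z)))"
proof -
  have zO: "z \<in> Obj C" using z by (simp add: initial_object_def)
  note TF = dist_lawD(1)[OF T] and Bz = endofunctorD(1)[OF B zO]
  note i = initial_arrow_in_Hom[OF z Bz]
  have n: "nat_trans C (const_endo C X) T \<kappa>" using \<kappa> by (simp add: dist_law_morphism_def)
  have k: "\<kappa> z \<in> Hom C X (fobj T z)"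
    using nat_transD(2)[OF n zO] zO by (simp add: const_endo_def)
  have "(\<tau> z \<cdot> farr T (initial_arrow C z (fobj B z))) \<cdot> \<kappa> z = \<tau> z \<cdot> \<kappa> (fobj B z)"
    using Cmp_assoc[OF k endofunctorD(2)[OF TF i] dist_lawD(2)[OF T zO]]
      nat_trans_const_endo_initial[OF z n Bz] by simp
  also have "\<dots> = farr B (\<kappa> z) \<cdot> f"
    using dist_law_morphismD[OF \<kappa> zO] zO by simp
  finally show ?thesis using k by (simp add: coalgebra_morphism_def)
qed

text \<open>Uniqueness of arrows out of \<open>z\<close> makes the extension of \<open>h\<close>
  natural. The coalgebra square gives compatibility with \<tau> at \<open>z\<close>, and naturality
  of \<tau> along \<open>!_x\<close> carries it to every \<open>x\<close>.\<close>

lemma const_morphism_of_coalgebra_morphism: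
  assumes B: "endofunctor C B" and z: "initial_object C z" and T: "dist_law C B (T, \<tau>)"
    and f: "coalgebra C B (X, f)"
    and h: "coalgebra_morphism C B (X, f) h
      (fobj T z, \<tau> z \<cdot> farr T (initial_arrow C z (fobj B z)))"
  shows "dist_law_morphism C B (const_endo C X, \<lambda>x\<in>Obj C. f)
    (\<lambda>x\<in>Obj C. farr T (initial_arrow C z x) \<cdot> h) (T, \<tau>)" (is "dist_law_morphism C B _ ?\<kappa> _")
proof -
  have zO: "z \<in> Obj C" using z by (simp add: initial_object_def)
  have F: "f \<in> Hom C X (fobj B X)" using f by (simp add: coalgebra_def)
  let ?i = "initial_arrow C z"
  have H: "h \<in> Hom C X (fobj T z)" and hc: "(\<tau> z \<cdot> farr T (?i (fobj B z))) \<cdot> h = farr B h \<cdot> f"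
    using h by (auto simp: coalgebra_morphism_def)
  note TF = dist_lawD(1)[OF T]
  note i = initial_arrow_in_Hom[OF z] and B1 = endofunctorD(1)[OF B]
    and B2 = endofunctorD(2)[OF B] and T2 = endofunctorD(2)[OF TF]
    and t = dist_lawD(2)[OF T]
  have "nat_trans C (const_endo C X) T ?\<kappa>"
    unfolding nat_trans_def
  proof (intro conjI allI ballI)
    show "?\<kappa> \<in> extensional (Obj C)" by simp
    show "?\<kappa> x \<in> Hom C (fobj (const_endo C X) x) (fobj T x)" if "x \<in> Obj C" for x
      using that Cmp_in_Hom[OF H T2[OF i[OF that]]] by (simp add: const_endo_def)
    fix x y g assume g: "g \<in> Hom C x y"
    note xy = Hom_Obj[OF g]
    have "farr T g \<cdot> (farr T (?i x) \<cdot> h) = (farr T g \<cdot> farr T (?i x)) \<cdot> h"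
      using Cmp_assoc[OF H T2[OF i[OF xy(1)]] T2[OF g]] by simp
    also have "\<dots> = farr T (?i y) \<cdot> h"
      using endofunctorD(4)[OF TF i[OF xy(1)] g] initial_arrow_Cmp[OF z g] by simp
    finally show "farr T g \<cdot> ?\<kappa> x = ?\<kappa> y \<cdot> farr (const_endo C X) g"
      using xy Hom_Arr[OF g] Cmp_Ide[OF Cmp_in_Hom[OF H T2[OF i[OF xy(2)]]]]
      by (simp add: const_endo_def)
  qed
  moreover have "\<tau> x \<cdot> (farr T (?i (fobj B x)) \<cdot> h) = farr B (farr T (?i x) \<cdot> h) \<cdot> f"
    if x: "x \<in> Obj C" for x
  proof -
    note ix = i[OF x] and iB = i[OF B1[OF zO]]
    note Tix = T2[OF ix] and TiB = T2[OF iB] and TBix = T2[OF B2[OF ix]]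
    have "farr B (farr T (?i x) \<cdot> h) \<cdot> f = farr B (farr T (?i x)) \<cdot> (farr B h \<cdot> f)"
      using endofunctorD(4)[OF B H Tix] Cmp_assoc[OF F B2[OF H] B2[OF Tix]] by simp
    also have "\<dots> = farr B (farr T (?i x)) \<cdot> (\<tau> z \<cdot> (farr T (?i (fobj B z)) \<cdot> h))"
      using hc Cmp_assoc[OF H TiB t[OF zO]] by simp
    also have "\<dots> = (farr B (farr T (?i x)) \<cdot> \<tau> z) \<cdot> (farr T (?i (fobj B z)) \<cdot> h)"
      using Cmp_assoc[OF Cmp_in_Hom[OF H TiB] t[OF zO] B2[OF Tix]] by simp
    \<comment> \<open>Naturality of \<tau> at \<open>!_x\<close> exchanges the component at
      \<open>z\<close> for the one at \<open>x\<close>.\<close>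
    also have "\<dots> = (\<tau> x \<cdot> farr T (farr B (?i x))) \<cdot> (farr T (?i (fobj B z)) \<cdot> h)"
      using dist_law_natural[OF B T ix] by simp
    also have "\<dots> = \<tau> x \<cdot> ((farr T (farr B (?i x)) \<cdot> farr T (?i (fobj B z))) \<cdot> h)"
      using Cmp_assoc[OF Cmp_in_Hom[OF H TiB] TBix t[OF x]] Cmp_assoc[OF H TiB TBix] by simp
    \<comment> \<open>By initiality \<open>B !_x \<circ> !_(B z)\<close> is the unique arrow from
      \<open>z\<close> to \<open>B x\<close>.\<close>
    also have "\<dots> = \<tau> x \<cdot> (farr T (?i (fobj B x)) \<cdot> h)"
      using endofunctorD(4)[OF TF iB B2[OF ix]] initial_arrow_Cmp[OF z B2[OF ix]] by simp
    finally show ?thesis by simp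
  qed
  \<comment> \<open>\<open>B1\<close> ensures that the whiskering evaluates \<open>?\<kappa>\<close>
    at an object, inside its restricted domain.\<close>
  ultimately show ?thesis
    using B1
    by (auto simp: dist_law_morphism_def vcomp_def whisker_r_def whisker_l_def intro!: restrict_ext)
qed

section \<open>Finality of the companion and of coalgebras\<close>

lemma companionD:
  assumes "companion C B (T, \<tau>)"
  shows "dist_law C B (T, \<tau>)"
    and "dist_law C B (F, \<phi>) \<Longrightarrow> \<exists>!\<kappa>. dist_law_morphism C B (F, \<phi>) \<kappa> (T, \<tau>)"
proof -
  have fin: "final_object (DL C B) (T, \<tau>)" using assms by (simp add: companion_def)
  then show T: "dist_law C B (T, \<tau>)" by (simp add: final_object_def DL_def)
  assume F: "dist_law C B (F, \<phi>)"
  then have "(F, \<phi>) \<in> Obj (DL C B)" by (simp add: DL_def)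
  then have "\<exists>!k. k \<in> Hom (DL C B) (F, \<phi>) (T, \<tau>)" using fin unfolding final_object_def by blast
  then show "\<exists>!\<kappa>. dist_law_morphism C B (F, \<phi>) \<kappa> (T, \<tau>)"
    using F T unfolding Hom_DL by blast
qed

text \<open>Arrows of \<open>Coalg C B\<close> are triples with source and target attached; once
  these are fixed, uniqueness of the triple is uniqueness of its middle entry.\<close>

lemma final_coalgebraI:
  assumes Z: "coalgebra C B Z"
    and ex: "\<And>X f. coalgebra C B (X, f) \<Longrightarrow> \<exists>!h. coalgebra_morphism C B (X, f) h Z"
  shows "final_coalgebra C B Z"
proof -
  have "\<exists>!k. k \<in> Hom (Coalg C B) X Z" if X: "coalgebra C B X" for X
  proof -
    have "\<exists>!h. coalgebra_morphism C B X h Z" using ex X by (cases X) blast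
    then show ?thesis using X Z unfolding Hom_Coalg by blast
  qed
  then show ?thesis using Z by (simp add: final_coalgebra_def final_object_def Coalg_def)
qed

lemma final_coalgebra_unique:
  assumes fin: "final_coalgebra C B Z" and X: "coalgebra C B X"
    and h: "coalgebra_morphism C B X h Z" and k: "coalgebra_morphism C B X k Z"
  shows "h = k"
proof -
  have Z: "coalgebra C B Z" and X': "X \<in> Obj (Coalg C B)"
    using fin X by (auto simp: final_coalgebra_def final_object_def Coalg_def)
  have "(X, h, Z) \<in> Hom (Coalg C B) X Z" "(X, k, Z) \<in> Hom (Coalg C B) X Z"
    using X Z h k unfolding Hom_Coalg by blast+
  then have "(X, h, Z) = (X, k, Z)"
    using fin X' unfolding final_coalgebra_def final_object_def by blast
  then show ?thesis by simp
qed

lemma final_coalgebra_companion_initial: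
  assumes B: "endofunctor C B" and z: "initial_object C z" and T: "companion C B (T, \<tau>)"
  shows "final_coalgebra C B (fobj T z, \<tau> z \<cdot> farr T (initial_arrow C z (fobj B z)))"
proof (rule final_coalgebraI)
  note TD = companionD(1)[OF T]
  show "coalgebra C B (fobj T z, \<tau> z \<cdot> farr T (initial_arrow C z (fobj B z)))"
    by (rule coalgebra_dist_law_initial[OF B z TD])
  fix X f assume f: "coalgebra C B (X, f)"
  have zO: "z \<in> Obj C" using z by (simp add: initial_object_def)
  obtain \<kappa> where \<kappa>: "dist_law_morphism C B (const_endo C X, \<lambda>x\<in>Obj C. f) \<kappa> (T, \<tau>)"
    and uniq: "\<And>\<rho>. dist_law_morphism C B (const_endo C X, \<lambda>x\<in>Obj C. f) \<rho> (T, \<tau>) \<Longrightarrow> \<rho> = \<kappa>"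
    using companionD(2)[OF T dist_law_const_endo[OF B f]] by blast
  show "\<exists>!h. coalgebra_morphism C B (X, f) h
      (fobj T z, \<tau> z \<cdot> farr T (initial_arrow C z (fobj B z)))"
  proof (rule ex1I)
    show "coalgebra_morphism C B (X, f) (\<kappa> z)
        (fobj T z, \<tau> z \<cdot> farr T (initial_arrow C z (fobj B z)))"
      by (rule coalgebra_morphism_of_const_morphism[OF B z TD \<kappa>])
    fix h assume h: "coalgebra_morphism C B (X, f) h
        (fobj T z, \<tau> z \<cdot> farr T (initial_arrow C z (fobj B z)))"
    then have H: "h \<in> Hom C X (fobj T z)" by (simp add: coalgebra_morphism_def)
    \<comment> \<open>The extension of \<open>h\<close> must be \<kappa>; evaluating at
      \<open>z\<close>, where \<open>!_z\<close> is the identity, recovers \<open>h\<close>.\<close>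
    have "\<kappa> z = farr T (initial_arrow C z z) \<cdot> h"
      using uniq[OF const_morphism_of_coalgebra_morphism[OF B z TD f h]] zO by auto
    then show "h = \<kappa> z"
      using initial_arrow_self[OF z] endofunctorD(3)[OF dist_lawD(1)[OF TD] zO] Ide_Cmp[OF H]
      by simp
  qed
qed

section \<open>The algebra induced on the final coalgebra\<close>

lemma coalgebra_dist_law:
  assumes F: "dist_law C B (F, \<phi>)" and Z: "coalgebra C B (Z, \<zeta>)"
  shows "coalgebra C B (fobj F Z, \<phi> Z \<cdot> farr F \<zeta>)"
  using Z endofunctorD(1,2)[OF dist_lawD(1)[OF F]] dist_lawD(2)[OF F] Cmp_in_Hom
  unfolding coalgebra_def by blast

text \<open>The defining equation of an induced algebra is literally the square of a coalgebra
  morphism from the lifting of \<open>(Z, \<zeta>)\<close> along \<phi>, so finality leaves at most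
  one solution.\<close>

lemma induced_algebra_final_coalgebraI:
  assumes fin: "final_coalgebra C B (Z, \<zeta>)" and F: "dist_law C B (F, \<phi>)"
    and \<alpha>: "induced_algebra_eq C B (Z, \<zeta>) (F, \<phi>) \<alpha>"
  shows "induced_algebra C B (Z, \<zeta>) (F, \<phi>) \<alpha>"
proof -
  have Z: "coalgebra C B (Z, \<zeta>)"
    using fin by (simp add: final_coalgebra_def final_object_def Coalg_def)
  have "induced_algebra_eq C B (Z, \<zeta>) (F, \<phi>) \<beta> \<longleftrightarrow>
      coalgebra_morphism C B (fobj F Z, \<phi> Z \<cdot> farr F \<zeta>) \<beta> (Z, \<zeta>)" for \<beta>
    by (simp add: induced_algebra_eq_def coalgebra_morphism_def)
  then show ?thesis
    using \<alpha> final_coalgebra_unique[OF fin coalgebra_dist_law[OF F Z]]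
    unfolding induced_algebra_def by blast
qed

text \<open>Naturality of \<mu> at \<open>! : z \<rightarrow> B z\<close> moves \<mu> next to
  \<tau>, where the multiplication law at \<open>z\<close> applies.\<close>

lemma induced_algebra_eq_monad_mult:
  assumes B: "endofunctor C B" and z: "initial_object C z" and M: "monad C T \<eta> \<mu>"
    and L: "monad_dist_law C B T \<eta> \<mu> \<tau>"
  shows "induced_algebra_eq C B (fobj T z, \<tau> z \<cdot> farr T (initial_arrow C z (fobj B z)))
    (T, \<tau>) (\<mu> z)"
proof -
  have zO: "z \<in> Obj C" using z by (simp add: initial_object_def)
  have T: "dist_law C B (T, \<tau>)" using L by (simp add: monad_dist_law_def)
  have n: "nat_trans C (comp_endo C T T) T \<mu>" using M by (simp add: monad_def)
  note TF = dist_lawD(1)[OF T]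
  note T1 = endofunctorD(1)[OF TF] and T2 = endofunctorD(2)[OF TF] and Bz = endofunctorD(1)[OF B zO]
    and B2 = endofunctorD(2)[OF B] and t = dist_lawD(2)[OF T]
  have m: "\<mu> x \<in> Hom C (fobj T (fobj T x)) (fobj T x)" if "x \<in> Obj C" for x
    using nat_transD(2)[OF n that] that by (simp add: comp_endo_def)
  let ?i = "initial_arrow C z (fobj B z)"
  note i = initial_arrow_in_Hom[OF z Bz]
  note Ti = T2[OF i] and TTi = T2[OF T2[OF i]] and Tt = T2[OF t[OF zO]] and tT = t[OF T1[OF zO]]
  have "vcomp C \<tau> (whisker_r C \<mu> B) z =
      vcomp C (whisker_l C B \<mu>) (vcomp C (whisker_r C \<tau> T) (whisker_l C T \<tau>)) z"
    using L by (simp add: monad_dist_law_def)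
  then have mult: "\<tau> z \<cdot> \<mu> (fobj B z) = farr B (\<mu> z) \<cdot> (\<tau> (fobj T z) \<cdot> farr T (\<tau> z))"
    using zO by (simp add: vcomp_def whisker_r_def whisker_l_def)
  have nat: "farr T ?i \<cdot> \<mu> z = \<mu> (fobj B z) \<cdot> farr T (farr T ?i)"
    using nat_transD(3)[OF n i] Hom_Arr[OF i] by (simp add: comp_endo_def)
  have "(\<tau> z \<cdot> farr T ?i) \<cdot> \<mu> z = \<tau> z \<cdot> (\<mu> (fobj B z) \<cdot> farr T (farr T ?i))"
    using Cmp_assoc[OF m[OF zO] Ti t[OF zO]] nat by simp
  also have "\<dots> = (farr B (\<mu> z) \<cdot> (\<tau> (fobj T z) \<cdot> farr T (\<tau> z))) \<cdot> farr T (farr T ?i)"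
    using Cmp_assoc[OF TTi m[OF Bz] t[OF zO]] mult by simp
  also have "\<dots> = farr B (\<mu> z) \<cdot> (\<tau> (fobj T z) \<cdot> (farr T (\<tau> z) \<cdot> farr T (farr T ?i)))"
    using Cmp_assoc[OF TTi Cmp_in_Hom[OF Tt tT] B2[OF m[OF zO]]] Cmp_assoc[OF TTi Tt tT] by simp
  \<comment> \<open>Functoriality of \<open>T\<close> reassembles \<open>T \<zeta>\<close> for the
    structure map \<zeta> of the final coalgebra.\<close>
  also have "\<dots> = farr B (\<mu> z) \<cdot> (\<tau> (fobj T z) \<cdot> farr T (\<tau> z \<cdot> farr T ?i))"
    using endofunctorD(4)[OF TF Ti t[OF zO]] by simp
  finally show ?thesis using m[OF zO] by (simp add: induced_algebra_eq_def)
qed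

end

theorem theorem4p4:
  fixes C :: "('o, 'm) cat" and B T :: "('o, 'm) endo"
    and \<tau> \<eta> \<mu> :: "'o \<Rightarrow> 'm" and z :: 'o
  assumes "category C"
    and "endofunctor C B"
    and "initial_object C z"
    and "companion C B (T, \<tau>)"
    and "monad C T \<eta> \<mu>"
    and "monad_dist_law C B T \<eta> \<mu> \<tau>"
  shows "final_coalgebra C B (fobj T z, \<tau> z \<cdot>\<^bsub>C\<^esub> farr T (initial_arrow C z (fobj B z)))
    \<and> induced_algebra C B (fobj T z, \<tau> z \<cdot>\<^bsub>C\<^esub> farr T (initial_arrow C z (fobj B z)))
          (T, \<tau>) (\<mu> z)"
proof -
  interpret category C by fact
  note fin = final_coalgebra_companion_initial[OF assms(2-4)]
  show ?thesis
    using fin induced_algebra_final_coalgebraI[OF fin companionD(1)[OF assms(4)]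
        induced_algebra_eq_monad_mult[OF assms(2,3,5,6)]] by blast
qed

end
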